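(* Let $a>0$ be the speed in the problem $\partial_t u+\partial_x(a(x)u)=0$ on $(x_L,x_R)$, $u(t,x_L)=g_L(t)$, $u(0,x)=u_0(x)$. Let $x_L=x_0<x_1<\dots<x_N=x_R$, and let each element $(x_{k-1},x_k)$, $k=1,\dots,N$, carry a (general) SBP discretisation $D^{(k)},M^{(k)},R^{(k)},B$ as defined in the context, with multiplication operator $\underline{\underline a}^{(k)}$ representing multiplication by $a$, such that $\underline{\underline a}^{(k)T}M^{(k)}$ is symmetric and positive definite for every $k$. Consider the semidiscretisation, for $k=1,\dots,N$, $$\partial_t\vec u^{(k)}=-D\,\underline{\underline a}\,\vec u-M^{-1}R^TB\big(\vec f^{\mathrm{num}}-R\,\underline{\underline a}\,\vec u\big),$$ where all quantities on the right carry the element index $(k)$ and $\vec f^{\mathrm{num},(k)}=(f^{\mathrm{num}}_{k-1},f^{\mathrm{num}}_k)^T$ with $f^{\mathrm{num}}_k$ the numerical flux at $x_k$, shared by the adjacent elements. - If the unsplit upwind flux $f^{\mathrm{num}}=(au)_-$ is used at the exterior boundaries $x_0$ and $x_N$, and (if $N>1$) at each interior boundary $x_k$, $1\le k\le N-1$, either the unsplit upwind flux $f^{\mathrm{num}}=(au)_-$ or the unsplit central flux $f^{\mathrm{num}}=\frac{(au)_-+(au)_+}{2}$ is used, then the semidiscretisation is both conservative and stable in the discrete norm $\|\cdot\|_{\underline{\underline a}^TM}$, in the sense defined in the context. - At each interior boundary the contribution to the rate of change of the energy, $$2\big((au)_+-(au)_-\big)f^{\mathrm{num}}-\big((au)_+^2-(au)_-^2\big),$$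 is $\le 0$ for the unsplit upwind flux (additional dissipation) and equal to $0$ for the unsplit central flux (no additional dissipation).
   Context: **SBP discretisation.** On an element $(x_{k-1},x_k)$ a function $u$ is represented in a nodal basis by the vector $\vec u=(u_0,\dots,u_p)^T$ of its values at pairwise different nodes $\xi_0,\dots,\xi_p$ (the nodes need not include the element boundaries). Matrices $D,M\in\mathbb{R}^{(p+1)\times(p+1)}$, $R\in\mathbb{R}^{2\times(p+1)}$ and $B=\operatorname{diag}(-1,1)$ form a ($q$th order, $q\ge 0$) SBP discretisation if: (i) $D$ is exact for polynomials of degree $\le q$ (it maps nodal values to nodal values of the derivative); in particular $D\vec 1=0$, where $\vec 1=(1,\dots,1)^T$; (ii) $M$ is symmetric and positive definite; (iii) $MD+D^TM=R^TBR$ (SBP property); (iv) $\vec u^TR^TBR\vec v=uv\big|_{x_{k-1}}^{x_k}$ for all polynomials $u,v$ of degree $\le r$, for some $r\ge q$. $R$ is the interpolation operator to the element boundary: $R\vec u$ approximates $(u(x_{k-1}),u(x_k))^T$, and it reproduces constants, $R\vec 1=(1,1)^T$. The operators may differ from element to element. **Multiplication operator.** $\underline{\underline a}=\operatorname{diag}(\vec a)$, where $\vec a$ is the vector discretising $a$ on the element; it is independent of time. **Boundary values.** $\big((au)_L^{(k)},(au)_R^{(k)}\big)^T:=R^{(k)}\underline{\underline a}^{(k)}\vec u^{(k)}$ (interpolation of the product). At an interior boundary $x_k$, $(au)_-:=(au)_R^{(k)}$ and $(au)_+:=(au)_L^{(k+1)}$. At the left exterior boundary the boundary datum is inserted as left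 state, so the unsplit upwind flux is $f^{\mathrm{num}}_0=(ag)_L:=a(x_L)g_L$; at the right exterior boundary it is $f^{\mathrm{num}}_N=(au)_R^{(N)}$. **Conservative.** On each element $\vec 1^TM^{(k)}\partial_t\vec u^{(k)}=-\vec 1^TR^{(k)T}B\vec f^{\mathrm{num},(k)}=f^{\mathrm{num}}_{k-1}-f^{\mathrm{num}}_k$, so that $$\frac{d}{dt}\sum_{k=1}^N\vec 1^TM^{(k)}\vec u^{(k)}=f^{\mathrm{num}}_0-f^{\mathrm{num}}_N.$$ **Stable in the discrete norm.** With $\|\vec u\|_{\underline{\underline a}^TM}^2=\vec u^T\underline{\underline a}^TM\vec u$, $$\frac{d}{dt}\sum_{k=1}^N\|\vec u^{(k)}\|_{\underline{\underline a}^{(k)T}M^{(k)}}^2\le (a(x_L)g_L)^2-\big((au)_R^{(N)}\big)^2\le (a(x_L)g_L)^2,$$ mimicking $\frac{d}{dt}\int_{x_L}^{x_R}a\,u^2=a(x_L)^2g_L^2-a(x_R)^2u(x_R)^2\le a(x_L)^2g_L^2$. Here $\vec u^{(k)}(t)$ is a differentiable solution of the semidiscretisation. *)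

theory Defs
  imports
    Complex_Main
    "HOL-Computational_Algebra.Polynomial"
    "Jordan_Normal_Form.Gauss_Jordan_Elimination"
begin

definition ones :: "nat \<Rightarrow> real vec" where
  "ones n = vec n (\<lambda>_. 1)"

definition sym_pos_def :: "nat \<Rightarrow> real mat \<Rightarrow> bool" where
  "sym_pos_def n A \<longleftrightarrow> A \<in> carrier_mat n n \<and> transpose_mat A = A \<and>
     (\<forall>v \<in> carrier_vec n. v \<noteq> 0\<^sub>v n \<longrightarrow> 0 < v \<bullet> (A *\<^sub>v v))"

(* mat_inverse returns an option; the value is only meaningful for invertible A. *)
definition minv :: "real mat \<Rightarrow> real mat" where
  "minv A = the (mat_inverse A)"

definition Bmat :: "real mat" where
  "Bmat = mat_diag 2 (\<lambda>i. if i = 0 then -1 else 1)"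


section \<open>SBP operators on one element\<close>

record sbp =
  nodes :: "real vec"
  Dmat :: "real mat"
  Mmat :: "real mat"
  Rmat :: "real mat"

abbreviation size_of :: "sbp \<Rightarrow> nat" where
  "size_of E \<equiv> dim_vec (nodes E)"

definition nodal :: "sbp \<Rightarrow> (real \<Rightarrow> real) \<Rightarrow> real vec" where
  "nodal E u = vec (size_of E) (\<lambda>i. u (nodes E $ i))"

(* The operators are those of the physical element (l, r), not of a reference element.
   Nodes may, but need not, include l and r. *)
definition sbp_discretisation :: "nat \<Rightarrow> real \<Rightarrow> real \<Rightarrow> sbp \<Rightarrow> bool" where
  "sbp_discretisation q l r E \<longleftrightarrow>
     (let n = size_of E; D = Dmat E; M = Mmat E; R = Rmat E in
       0 < n \<and>
       (\<forall>i<n. \<forall>j<n. i \<noteq> j \<longrightarrow> nodes E $ i \<noteq> nodes E $ j) \<and>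
       (\<forall>i<n. nodes E $ i \<in> {l..r}) \<and>
       D \<in> carrier_mat n n \<and> M \<in> carrier_mat n n \<and> R \<in> carrier_mat 2 n \<and>
       (\<forall>u :: real poly. degree u \<le> q \<longrightarrow>
          D *\<^sub>v nodal E (poly u) = nodal E (poly (pderiv u))) \<and>
       sym_pos_def n M \<and>
       M * D + transpose_mat D * M = transpose_mat R * Bmat * R \<and>
       (\<exists>d\<ge>q. \<forall>u v :: real poly. degree u \<le> d \<longrightarrow> degree v \<le> d \<longrightarrow>
          nodal E (poly u) \<bullet> ((transpose_mat R * Bmat * R) *\<^sub>v nodal E (poly v))
            = poly u r * poly v r - poly u l * poly v l) \<and>
       R *\<^sub>v ones n = ones 2)"

definition mult_op :: "(real \<Rightarrow> real) \<Rightarrow> sbp \<Rightarrow> real mat" where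
  "mult_op a E = mat_diag (size_of E) (\<lambda>i. nodal E a $ i)"


section \<open>Boundary states and numerical fluxes\<close>

text \<open>
  Throughout, \<open>N\<close> is the number of elements, \<open>x 0 < \<dots> < x N\<close> the grid, \<open>E k\<close> the operators on
  the element from \<open>x (k - 1)\<close> to \<open>x k\<close> (for \<open>1 \<le> k \<le> N\<close>), \<open>a\<close> the speed, \<open>g\<close> the boundary
  datum as a function of time, \<open>\<gamma>\<close> a value of \<open>g\<close>, \<open>U k\<close> the vector of nodal values on element
  \<open>k\<close> at one instant, and \<open>h k\<close> the numerical flux at \<open>x k\<close> as a function of the left and right
  states \<open>(au)\<^sub>-\<close> and \<open>(au)\<^sub>+\<close>.
\<close>

definition au_bdry :: "(real \<Rightarrow> real) \<Rightarrow> sbp \<Rightarrow> real vec \<Rightarrow> real vec" where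
  "au_bdry a E u = Rmat E *\<^sub>v (mult_op a E *\<^sub>v u)"

definition au_L :: "(nat \<Rightarrow> sbp) \<Rightarrow> (real \<Rightarrow> real) \<Rightarrow> (nat \<Rightarrow> real vec) \<Rightarrow> nat \<Rightarrow> real" where
  "au_L E a U k = au_bdry a (E k) (U k) $ 0"

definition au_R :: "(nat \<Rightarrow> sbp) \<Rightarrow> (real \<Rightarrow> real) \<Rightarrow> (nat \<Rightarrow> real vec) \<Rightarrow> nat \<Rightarrow> real" where
  "au_R E a U k = au_bdry a (E k) (U k) $ 1"

definition au_minus ::
  "(nat \<Rightarrow> real) \<Rightarrow> (nat \<Rightarrow> sbp) \<Rightarrow> (real \<Rightarrow> real) \<Rightarrow> real \<Rightarrow> (nat \<Rightarrow> real vec) \<Rightarrow> nat \<Rightarrow> real" where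
  "au_minus x E a \<gamma> U k = (if k = 0 then a (x 0) * \<gamma> else au_R E a U k)"

(* There is no exterior state at the outflow boundary x N; the interior value is used as a
   placeholder, which the upwind flux ignores. *)
definition au_plus ::
  "nat \<Rightarrow> (nat \<Rightarrow> sbp) \<Rightarrow> (real \<Rightarrow> real) \<Rightarrow> (nat \<Rightarrow> real vec) \<Rightarrow> nat \<Rightarrow> real" where
  "au_plus N E a U k = (if k < N then au_L E a U (k + 1) else au_R E a U N)"

definition upwind_flux :: "real \<Rightarrow> real \<Rightarrow> real" where
  "upwind_flux m p = m"

definition central_flux :: "real \<Rightarrow> real \<Rightarrow> real" where
  "central_flux m p = (m + p) / 2"

definition num_flux ::
  "nat \<Rightarrow> (nat \<Rightarrow> real) \<Rightarrow> (nat \<Rightarrow> sbp) \<Rightarrow> (real \<Rightarrow> real) \<Rightarrow> (nat \<Rightarrow> real \<Rightarrow> real \<Rightarrow> real)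
     \<Rightarrow> real \<Rightarrow> (nat \<Rightarrow> real vec) \<Rightarrow> nat \<Rightarrow> real" where
  "num_flux N x E a h \<gamma> U k = h k (au_minus x E a \<gamma> U k) (au_plus N E a U k)"

definition flux_vec ::
  "nat \<Rightarrow> (nat \<Rightarrow> real) \<Rightarrow> (nat \<Rightarrow> sbp) \<Rightarrow> (real \<Rightarrow> real) \<Rightarrow> (nat \<Rightarrow> real \<Rightarrow> real \<Rightarrow> real)
     \<Rightarrow> real \<Rightarrow> (nat \<Rightarrow> real vec) \<Rightarrow> nat \<Rightarrow> real vec" where
  "flux_vec N x E a h \<gamma> U k =
     vec_of_list [num_flux N x E a h \<gamma> U (k - 1), num_flux N x E a h \<gamma> U k]"


section \<open>The semidiscretisation\<close>

definition semi_rhs ::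
  "nat \<Rightarrow> (nat \<Rightarrow> real) \<Rightarrow> (nat \<Rightarrow> sbp) \<Rightarrow> (real \<Rightarrow> real) \<Rightarrow> (nat \<Rightarrow> real \<Rightarrow> real \<Rightarrow> real)
     \<Rightarrow> real \<Rightarrow> (nat \<Rightarrow> real vec) \<Rightarrow> nat \<Rightarrow> real vec" where
  "semi_rhs N x E a h \<gamma> U k =
     - (Dmat (E k) *\<^sub>v (mult_op a (E k) *\<^sub>v U k))
     - (minv (Mmat (E k)) * transpose_mat (Rmat (E k)) * Bmat)
         *\<^sub>v (flux_vec N x E a h \<gamma> U k - Rmat (E k) *\<^sub>v (mult_op a (E k) *\<^sub>v U k))"

definition has_vec_deriv :: "nat \<Rightarrow> (real \<Rightarrow> real vec) \<Rightarrow> real vec \<Rightarrow> real \<Rightarrow> real set \<Rightarrow> bool" where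
  "has_vec_deriv n v v' t T \<longleftrightarrow>
     (\<forall>s\<in>T. v s \<in> carrier_vec n) \<and> v' \<in> carrier_vec n \<and>
     (\<forall>i<n. ((\<lambda>s. v s $ i) has_real_derivative v' $ i) (at t within T))"

definition semi_solution ::
  "nat \<Rightarrow> (nat \<Rightarrow> real) \<Rightarrow> (nat \<Rightarrow> sbp) \<Rightarrow> (real \<Rightarrow> real) \<Rightarrow> (nat \<Rightarrow> real \<Rightarrow> real \<Rightarrow> real)
     \<Rightarrow> (real \<Rightarrow> real) \<Rightarrow> real \<Rightarrow> (real \<Rightarrow> nat \<Rightarrow> real vec) \<Rightarrow> bool" where
  "semi_solution N x E a h g \<tau> u \<longleftrightarrow>
     (\<forall>t\<in>{0..\<tau>}. \<forall>k\<in>{1..N}.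
        has_vec_deriv (size_of (E k)) (\<lambda>s. u s k) (semi_rhs N x E a h (g t) (u t) k) t {0..\<tau>})"

definition total_mass :: "nat \<Rightarrow> (nat \<Rightarrow> sbp) \<Rightarrow> (nat \<Rightarrow> real vec) \<Rightarrow> real" where
  "total_mass N E U = (\<Sum>k=1..N. ones (size_of (E k)) \<bullet> (Mmat (E k) *\<^sub>v U k))"

definition norm_sq :: "real mat \<Rightarrow> real vec \<Rightarrow> real" where
  "norm_sq A u = u \<bullet> (A *\<^sub>v u)"

definition energy :: "nat \<Rightarrow> (nat \<Rightarrow> sbp) \<Rightarrow> (real \<Rightarrow> real) \<Rightarrow> (nat \<Rightarrow> real vec) \<Rightarrow> real" where
  "energy N E a U =
     (\<Sum>k=1..N. norm_sq (transpose_mat (mult_op a (E k)) * Mmat (E k)) (U k))"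

definition conservative ::
  "nat \<Rightarrow> (nat \<Rightarrow> real) \<Rightarrow> (nat \<Rightarrow> sbp) \<Rightarrow> (real \<Rightarrow> real) \<Rightarrow> (nat \<Rightarrow> real \<Rightarrow> real \<Rightarrow> real)
     \<Rightarrow> (real \<Rightarrow> real) \<Rightarrow> bool" where
  "conservative N x E a h g \<longleftrightarrow>
     (\<forall>\<tau>>0. \<forall>u. semi_solution N x E a h g \<tau> u \<longrightarrow> (\<forall>t\<in>{0..\<tau>}.
        (\<forall>k\<in>{1..N}. \<exists>u'. has_vec_deriv (size_of (E k)) (\<lambda>s. u s k) u' t {0..\<tau>} \<and>
           ones (size_of (E k)) \<bullet> (Mmat (E k) *\<^sub>v u')
             = - (ones (size_of (E k)) \<bullet>
                   ((transpose_mat (Rmat (E k)) * Bmat) *\<^sub>v flux_vec N x E a h (g t) (u t) k)) \<and>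
           ones (size_of (E k)) \<bullet> (Mmat (E k) *\<^sub>v u')
             = num_flux N x E a h (g t) (u t) (k - 1) - num_flux N x E a h (g t) (u t) k) \<and>
        ((\<lambda>s. total_mass N E (u s)) has_real_derivative
           num_flux N x E a h (g t) (u t) 0 - num_flux N x E a h (g t) (u t) N)
          (at t within {0..\<tau>})))"

definition energy_stable ::
  "nat \<Rightarrow> (nat \<Rightarrow> real) \<Rightarrow> (nat \<Rightarrow> sbp) \<Rightarrow> (real \<Rightarrow> real) \<Rightarrow> (nat \<Rightarrow> real \<Rightarrow> real \<Rightarrow> real)
     \<Rightarrow> (real \<Rightarrow> real) \<Rightarrow> bool" where
  "energy_stable N x E a h g \<longleftrightarrow>
     (\<forall>\<tau>>0. \<forall>u. semi_solution N x E a h g \<tau> u \<longrightarrow> (\<forall>t\<in>{0..\<tau>}.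
        \<exists>e'. ((\<lambda>s. energy N E a (u s)) has_real_derivative e') (at t within {0..\<tau>}) \<and>
          e' \<le> (a (x 0) * g t)\<^sup>2 - (au_R E a (u t) N)\<^sup>2 \<and>
          (a (x 0) * g t)\<^sup>2 - (au_R E a (u t) N)\<^sup>2 \<le> (a (x 0) * g t)\<^sup>2))"

definition interior_contribution ::
  "nat \<Rightarrow> (nat \<Rightarrow> real) \<Rightarrow> (nat \<Rightarrow> sbp) \<Rightarrow> (real \<Rightarrow> real) \<Rightarrow> (nat \<Rightarrow> real \<Rightarrow> real \<Rightarrow> real)
     \<Rightarrow> real \<Rightarrow> (nat \<Rightarrow> real vec) \<Rightarrow> nat \<Rightarrow> real" where
  "interior_contribution N x E a h \<gamma> U k =
     2 * (au_plus N E a U k - au_minus x E a \<gamma> U k) * num_flux N x E a h \<gamma> U k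
     - ((au_plus N E a U k)\<^sup>2 - (au_minus x E a \<gamma> U k)\<^sup>2)"

(* What remains in the energy rate besides the interior boundaries: the terms at x 0 and x N. *)
definition exterior_contribution ::
  "nat \<Rightarrow> (nat \<Rightarrow> real) \<Rightarrow> (nat \<Rightarrow> sbp) \<Rightarrow> (real \<Rightarrow> real) \<Rightarrow> (nat \<Rightarrow> real \<Rightarrow> real \<Rightarrow> real)
     \<Rightarrow> real \<Rightarrow> (nat \<Rightarrow> real vec) \<Rightarrow> real" where
  "exterior_contribution N x E a h \<gamma> U =
     (2 * au_L E a U 1 * num_flux N x E a h \<gamma> U 0 - (au_L E a U 1)\<^sup>2)
     - (2 * au_R E a U N * num_flux N x E a h \<gamma> U N - (au_R E a U N)\<^sup>2)"

end

theory Submission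
  imports
    Defs
    "Jordan_Normal_Form.Determinant"
begin

text \<open>
  Tested against a vector \<open>v\<close> in the \<open>M\<close>-inner product, the semidiscretisation
  \<open>u' = - D w - M\<^sup>-\<^sup>1 R\<^sup>T B (f - R w)\<close> with \<open>w = a u\<close> takes, thanks to the SBP property, the weak
  form \<open>v\<^sup>T M u' = w\<^sup>T M D v - (R v)\<^sup>T B f\<close> (lemma \<open>semi_rhs_weak_form\<close>): the derivative moves to
  the test vector and only the numerical fluxes are left at the element boundary. Both claims come
  from a choice of \<open>v\<close>.

  For \<open>v = 1\<close> the volume term vanishes, because \<open>D\<close> annihilates constants, and \<open>R 1 = (1, 1)\<^sup>T\<close>
  leaves the difference of the two fluxes. This is conservation on one element, and the sum over the
  elements telescopes since adjacent elements share their flux.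

  For \<open>v = w\<close> the left-hand side is half the rate of change of \<open>u\<^sup>T a\<^sup>T M u\<close>. Here the
  unsplit form matters: the semidiscretisation only sees \<open>u\<close> through the product \<open>w\<close>, and in the
  norm weighted by \<open>a\<close> this same \<open>w\<close> is the natural test vector, so the SBP property turns the
  volume term into \<open>(R w)\<^sup>T B (R w) / 2\<close>, and the rate becomes
  \<open>(2 w\<^sub>L f\<^sub>L - w\<^sub>L\<^sup>2) - (2 w\<^sub>R f\<^sub>R - w\<^sub>R\<^sup>2)\<close> with the boundary values \<open>w\<^sub>L\<close> and \<open>w\<^sub>R\<close> of \<open>w\<close>.
  Regrouping the sum by grid points instead of elements leaves at an interior point, with left
  state \<open>m\<close> and right state \<open>p\<close>, the quantity \<open>2 (p - m) f - (p\<^sup>2 - m\<^sup>2)\<close>. It equals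
  \<open>- (p - m)\<^sup>2\<close> for \<open>f = m\<close> and \<open>0\<close> for \<open>f = (m + p) / 2\<close>. At the inflow boundary,
  \<open>2 p f - p\<^sup>2 = f\<^sup>2 - (p - f)\<^sup>2\<close> is at most the square of the inflow datum \<open>f\<close>, and at the
  outflow boundary \<open>f = m\<close> gives \<open>- m\<^sup>2\<close>.
\<close>

section \<open>Symmetric positive definite matrices\<close>

text \<open>
  The quadratic form vanishes on the kernel, so definiteness makes the kernel trivial and the
  determinant nonzero.
\<close>

lemma sym_pos_def_minv:
  assumes "sym_pos_def n A"
  shows "minv A \<in> carrier_mat n n" and "A * minv A = 1\<^sub>m n"
proof -
  have A: "A \<in> carrier_mat n n"
    and pos: "\<And>v. v \<in> carrier_vec n \<Longrightarrow> v \<noteq> 0\<^sub>v n \<Longrightarrow> 0 < v \<bullet> (A *\<^sub>v v)"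
    using assms by (auto simp: sym_pos_def_def)
  have "det A \<noteq> 0"
  proof
    assume "det A = 0"
    then obtain v where v: "v \<in> carrier_vec n" "v \<noteq> 0\<^sub>v n" "A *\<^sub>v v = 0\<^sub>v n"
      using det_0_iff_vec_prod_zero[OF A] by blast
    then show False using pos[OF v(1,2)] by simp
  qed
  then have "A \<in> Units (ring_mat TYPE(real) n ())"
    by (rule det_non_zero_imp_unit[OF A])
  then obtain C where C: "mat_inverse A = Some C"
    using mat_inverse(1)[OF A, where b = "()"] by (cases "mat_inverse A") auto
  show "minv A \<in> carrier_mat n n" "A * minv A = 1\<^sub>m n"
    using mat_inverse(2)[OF A C] C by (auto simp: minv_def)
qed

lemma sym_pos_def_bilinear_commute:
  assumes "sym_pos_def n A" "v \<in> carrier_vec n" "w \<in> carrier_vec n"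
  shows "v \<bullet> (A *\<^sub>v w) = w \<bullet> (A *\<^sub>v v)"
proof -
  have A: "A \<in> carrier_mat n n" "transpose_mat A = A" using assms by (auto simp: sym_pos_def_def)
  have "v \<bullet> (A *\<^sub>v w) = (A *\<^sub>v v) \<bullet> w"
    using transpose_vec_mult_scalar[OF A(1) assms(3,2)] A(2) by simp
  also have "\<dots> = w \<bullet> (A *\<^sub>v v)" using A assms by (intro comm_scalar_prod) auto
  finally show ?thesis .
qed


section \<open>Summation by parts on one element\<close>

lemma scalar_prod_transpose_mult:
  fixes A :: "real mat"
  assumes "A \<in> carrier_mat nr nc" "x \<in> carrier_vec nc" "y \<in> carrier_vec nr"
  shows "x \<bullet> (transpose_mat A *\<^sub>v y) = (A *\<^sub>v x) \<bullet> y"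
  by (metis assms comm_scalar_prod mult_mat_vec_carrier transpose_carrier_mat transpose_vec_mult_scalar)

lemma mult_mat_vec_uminus:
  fixes A :: "real mat"
  assumes "A \<in> carrier_mat nr nc" "x \<in> carrier_vec nc"
  shows "A *\<^sub>v (- x) = - (A *\<^sub>v x)"
  using assms by (intro eq_vecI) auto

lemma Bmat_carrier: "Bmat \<in> carrier_mat 2 2"
  by (simp add: Bmat_def)

lemma scalar_prod_Bmat:
  assumes "y \<in> carrier_vec 2" "z \<in> carrier_vec 2"
  shows "y \<bullet> (Bmat *\<^sub>v z) = y $ 1 * z $ 1 - y $ 0 * z $ 0"
  using assms
  by (auto simp: Bmat_def mat_diag_def scalar_prod_def mult_mat_vec_def numeral_2_eq_2)

lemma ones_carrier: "ones n \<in> carrier_vec n"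
  by (simp add: ones_def)

lemma mult_op_carrier: "mult_op a E \<in> carrier_mat (size_of E) (size_of E)"
  by (simp add: mult_op_def)

lemma sbp_discretisationD:
  assumes "sbp_discretisation q l r E"
  shows "Dmat E \<in> carrier_mat (size_of E) (size_of E)"
    and "Mmat E \<in> carrier_mat (size_of E) (size_of E)"
    and "Rmat E \<in> carrier_mat 2 (size_of E)"
    and "sym_pos_def (size_of E) (Mmat E)"
    and "Mmat E * Dmat E + transpose_mat (Dmat E) * Mmat E
           = transpose_mat (Rmat E) * Bmat * Rmat E"
    and "Rmat E *\<^sub>v ones (size_of E) = ones 2"
  using assms by (auto simp: sbp_discretisation_def Let_def)

text \<open>Constants have degree \<open>0 \<le> q\<close>, so every order of exactness covers them.\<close>

lemma sbp_derivative_ones: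
  assumes "sbp_discretisation q l r E"
  shows "Dmat E *\<^sub>v ones (size_of E) = 0\<^sub>v (size_of E)"
proof -
  have "Dmat E *\<^sub>v nodal E (poly [:1:]) = nodal E (poly (pderiv [:1:]))"
    using assms unfolding sbp_discretisation_def Let_def by (metis degree_pCons_0 le0)
  moreover have "nodal E (poly [:1:]) = ones (size_of E)" by (auto simp: nodal_def ones_def)
  moreover have "nodal E (poly (pderiv [:1:])) = 0\<^sub>v (size_of E)"
    by (auto simp: nodal_def pderiv_pCons)
  ultimately show ?thesis by simp
qed

lemma sbp_summation_by_parts:
  assumes sbp: "sbp_discretisation q l r E"
    and v: "v \<in> carrier_vec (size_of E)" and w: "w \<in> carrier_vec (size_of E)"
  shows "v \<bullet> (Mmat E *\<^sub>v (Dmat E *\<^sub>v w)) + w \<bullet> (Mmat E *\<^sub>v (Dmat E *\<^sub>v v))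
           = (Rmat E *\<^sub>v v) \<bullet> (Bmat *\<^sub>v (Rmat E *\<^sub>v w))"
proof -
  let ?n = "size_of E"
  note D = sbp_discretisationD(1)[OF sbp] and M = sbp_discretisationD(2)[OF sbp]
    and R = sbp_discretisationD(3)[OF sbp]
  have DT: "transpose_mat (Dmat E) \<in> carrier_mat ?n ?n"
    and RT: "transpose_mat (Rmat E) \<in> carrier_mat ?n 2" using D R by simp_all
  have Dv: "Dmat E *\<^sub>v v \<in> carrier_vec ?n" and Dw: "Dmat E *\<^sub>v w \<in> carrier_vec ?n"
    and Mw: "Mmat E *\<^sub>v w \<in> carrier_vec ?n"
    and Rw: "Rmat E *\<^sub>v w \<in> carrier_vec 2"
    by (simp_all add: mult_mat_vec_carrier[OF D v] mult_mat_vec_carrier[OF D w]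
        mult_mat_vec_carrier[OF M w] mult_mat_vec_carrier[OF R w])
  have "w \<bullet> (Mmat E *\<^sub>v (Dmat E *\<^sub>v v)) = (Dmat E *\<^sub>v v) \<bullet> (Mmat E *\<^sub>v w)"
    by (rule sym_pos_def_bilinear_commute[OF sbp_discretisationD(4)[OF sbp] w Dv])
  also have "\<dots> = v \<bullet> (transpose_mat (Dmat E) *\<^sub>v (Mmat E *\<^sub>v w))"
    by (rule scalar_prod_transpose_mult[symmetric, OF D v Mw])
  finally have "v \<bullet> (Mmat E *\<^sub>v (Dmat E *\<^sub>v w)) + w \<bullet> (Mmat E *\<^sub>v (Dmat E *\<^sub>v v))
      = v \<bullet> (Mmat E *\<^sub>v (Dmat E *\<^sub>v w) + transpose_mat (Dmat E) *\<^sub>v (Mmat E *\<^sub>v w))"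
    using scalar_prod_add_distrib[OF v mult_mat_vec_carrier[OF M Dw]
        mult_mat_vec_carrier[OF DT Mw]] by simp
  also have "Mmat E *\<^sub>v (Dmat E *\<^sub>v w) + transpose_mat (Dmat E) *\<^sub>v (Mmat E *\<^sub>v w)
      = (Mmat E * Dmat E + transpose_mat (Dmat E) * Mmat E) *\<^sub>v w"
    unfolding add_mult_distrib_mat_vec[OF mult_carrier_mat[OF M D] mult_carrier_mat[OF DT M] w]
      assoc_mult_mat_vec[OF M D w] assoc_mult_mat_vec[OF DT M w] ..
  also have "\<dots> = transpose_mat (Rmat E) *\<^sub>v (Bmat *\<^sub>v (Rmat E *\<^sub>v w))"
    unfolding sbp_discretisationD(5)[OF sbp]
      assoc_mult_mat_vec[OF mult_carrier_mat[OF RT Bmat_carrier] R w]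
      assoc_mult_mat_vec[OF RT Bmat_carrier Rw] ..
  also have "v \<bullet> \<dots> = (Rmat E *\<^sub>v v) \<bullet> (Bmat *\<^sub>v (Rmat E *\<^sub>v w))"
    by (rule scalar_prod_transpose_mult[OF R v mult_mat_vec_carrier[OF Bmat_carrier Rw]])
  finally show ?thesis .
qed


section \<open>The semidiscretisation on one element\<close>

lemma au_bdry_carrier:
  assumes "sbp_discretisation q l r E" "v \<in> carrier_vec (size_of E)"
  shows "au_bdry a E v \<in> carrier_vec 2"
  unfolding au_bdry_def
  by (intro mult_mat_vec_carrier[OF sbp_discretisationD(3)[OF assms(1)]]
      mult_mat_vec_carrier[OF mult_op_carrier assms(2)])

lemma flux_vec_carrier: "flux_vec N x E a h \<gamma> U k \<in> carrier_vec 2"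
  unfolding flux_vec_def by (rule carrier_vecI) (simp only: dim_vec_of_list list.size)

lemma flux_vec_nth:
  "flux_vec N x E a h \<gamma> U k $ 0 = num_flux N x E a h \<gamma> U (k - 1)"
  "flux_vec N x E a h \<gamma> U k $ 1 = num_flux N x E a h \<gamma> U k"
  unfolding flux_vec_def vec_of_list_index by simp_all

text \<open>
  The factor \<open>M\<close> of the inner product cancels the \<open>M\<^sup>-\<^sup>1\<close> in front of the flux correction, and
  summation by parts absorbs the interior trace \<open>R w\<close> of that correction.
\<close>

lemma semi_rhs_weak_form:
  fixes N x E a h \<gamma> U k
  assumes sbp: "sbp_discretisation q l r (E k)"
    and v: "v \<in> carrier_vec (size_of (E k))" and U: "U k \<in> carrier_vec (size_of (E k))"
  shows "v \<bullet> (Mmat (E k) *\<^sub>v semi_rhs N x E a h \<gamma> U k)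
           = (mult_op a (E k) *\<^sub>v U k) \<bullet> (Mmat (E k) *\<^sub>v (Dmat (E k) *\<^sub>v v))
             - (Rmat (E k) *\<^sub>v v) \<bullet> (Bmat *\<^sub>v flux_vec N x E a h \<gamma> U k)"
proof -
  let ?n = "size_of (E k)" and ?D = "Dmat (E k)" and ?M = "Mmat (E k)" and ?R = "Rmat (E k)"
  define w where "w = mult_op a (E k) *\<^sub>v U k"
  define f where "f = flux_vec N x E a h \<gamma> U k"
  define c where "c = transpose_mat ?R *\<^sub>v (Bmat *\<^sub>v (f - ?R *\<^sub>v w))"
  note D = sbp_discretisationD(1)[OF sbp] and M = sbp_discretisationD(2)[OF sbp]
    and R = sbp_discretisationD(3)[OF sbp]
  note I = sym_pos_def_minv[OF sbp_discretisationD(4)[OF sbp]]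
  have w: "w \<in> carrier_vec ?n" unfolding w_def by (rule mult_mat_vec_carrier[OF mult_op_carrier U])
  have f: "f \<in> carrier_vec 2" unfolding f_def by (rule flux_vec_carrier)
  have Rw: "?R *\<^sub>v w \<in> carrier_vec 2" and Rv: "?R *\<^sub>v v \<in> carrier_vec 2"
    and Dw: "?D *\<^sub>v w \<in> carrier_vec ?n"
    by (simp_all add: mult_mat_vec_carrier[OF R w] mult_mat_vec_carrier[OF R v]
        mult_mat_vec_carrier[OF D w])
  have fRw: "f - ?R *\<^sub>v w \<in> carrier_vec 2" using f Rw by simp
  have Bf: "Bmat *\<^sub>v f \<in> carrier_vec 2" and BRw: "Bmat *\<^sub>v (?R *\<^sub>v w) \<in> carrier_vec 2"
    and BfRw: "Bmat *\<^sub>v (f - ?R *\<^sub>v w) \<in> carrier_vec 2"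
    using mult_mat_vec_carrier[OF Bmat_carrier] f Rw fRw by blast+
  have c: "c \<in> carrier_vec ?n"
    unfolding c_def using R by (intro mult_mat_vec_carrier[OF _ BfRw]) simp
  have Ic: "minv ?M *\<^sub>v c \<in> carrier_vec ?n" by (rule mult_mat_vec_carrier[OF I(1) c])
  have MIc: "?M *\<^sub>v (minv ?M *\<^sub>v c) = c"
    using assoc_mult_mat_vec[OF M I(1) c] I(2) c by simp
  have RT: "transpose_mat ?R \<in> carrier_mat ?n 2" using R by simp
  have "(minv ?M * transpose_mat ?R * Bmat) *\<^sub>v (f - ?R *\<^sub>v w) = minv ?M *\<^sub>v c"
    unfolding c_def
    by (simp add: assoc_mult_mat_vec[OF mult_carrier_mat[OF I(1) RT] Bmat_carrier fRw]
        assoc_mult_mat_vec[OF I(1) RT BfRw])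
  then have "semi_rhs N x E a h \<gamma> U k = - (?D *\<^sub>v w) - minv ?M *\<^sub>v c"
    by (simp add: semi_rhs_def w_def f_def)
  then have "?M *\<^sub>v semi_rhs N x E a h \<gamma> U k = - (?M *\<^sub>v (?D *\<^sub>v w)) - c"
    using mult_minus_distrib_mat_vec[OF M _ Ic, of "- (?D *\<^sub>v w)"]
      mult_mat_vec_uminus[OF M Dw] Dw MIc by simp
  moreover have MDw: "?M *\<^sub>v (?D *\<^sub>v w) \<in> carrier_vec ?n" by (rule mult_mat_vec_carrier[OF M Dw])
  ultimately have "v \<bullet> (?M *\<^sub>v semi_rhs N x E a h \<gamma> U k) = - (v \<bullet> (?M *\<^sub>v (?D *\<^sub>v w))) - v \<bullet> c"
    using scalar_prod_minus_distrib[OF v _ c, of "- (?M *\<^sub>v (?D *\<^sub>v w))"]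
      scalar_prod_uminus_right[OF trans[OF carrier_vecD[OF v] carrier_vecD[OF MDw, symmetric]]]
    by simp
  moreover have "v \<bullet> c = (?R *\<^sub>v v) \<bullet> (Bmat *\<^sub>v f) - (?R *\<^sub>v v) \<bullet> (Bmat *\<^sub>v (?R *\<^sub>v w))"
    unfolding c_def scalar_prod_transpose_mult[OF R v BfRw]
    unfolding mult_minus_distrib_mat_vec[OF Bmat_carrier f Rw]
    by (rule scalar_prod_minus_distrib[OF Rv Bf BRw])
  ultimately show ?thesis
    using sbp_summation_by_parts[OF sbp v w] by (simp add: w_def f_def)
qed

lemma element_flux_ones:
  assumes sbp: "sbp_discretisation q l r (E k)"
  shows "ones (size_of (E k)) \<bullet> ((transpose_mat (Rmat (E k)) * Bmat) *\<^sub>v flux_vec N x E a h \<gamma> U k)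
           = (Rmat (E k) *\<^sub>v ones (size_of (E k))) \<bullet> (Bmat *\<^sub>v flux_vec N x E a h \<gamma> U k)"
proof -
  note R = sbp_discretisationD(3)[OF sbp]
  have RT: "transpose_mat (Rmat (E k)) \<in> carrier_mat (size_of (E k)) 2" using R by simp
  show ?thesis
    unfolding assoc_mult_mat_vec[OF RT Bmat_carrier flux_vec_carrier]
    by (rule scalar_prod_transpose_mult[OF R ones_carrier
          mult_mat_vec_carrier[OF Bmat_carrier flux_vec_carrier]])
qed

lemma element_flux_difference:
  assumes sbp: "sbp_discretisation q l r (E k)"
  shows "(Rmat (E k) *\<^sub>v ones (size_of (E k))) \<bullet> (Bmat *\<^sub>v flux_vec N x E a h \<gamma> U k)
           = num_flux N x E a h \<gamma> U k - num_flux N x E a h \<gamma> U (k - 1)"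
  unfolding sbp_discretisationD(6)[OF sbp] scalar_prod_Bmat[OF ones_carrier flux_vec_carrier]
    flux_vec_nth by (simp add: ones_def)

lemma element_mass_rate:
  assumes sbp: "sbp_discretisation q l r (E k)" and U: "U k \<in> carrier_vec (size_of (E k))"
  shows "ones (size_of (E k)) \<bullet> (Mmat (E k) *\<^sub>v semi_rhs N x E a h \<gamma> U k)
           = num_flux N x E a h \<gamma> U (k - 1) - num_flux N x E a h \<gamma> U k"
proof -
  have "Mmat (E k) *\<^sub>v 0\<^sub>v (size_of (E k)) = 0\<^sub>v (size_of (E k))"
    using sbp_discretisationD(2)[OF sbp] by auto
  moreover have "mult_op a (E k) *\<^sub>v U k \<in> carrier_vec (size_of (E k))"
    by (rule mult_mat_vec_carrier[OF mult_op_carrier U])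
  ultimately show ?thesis
    unfolding semi_rhs_weak_form[where E = E and k = k and U = U, OF sbp ones_carrier U] sbp_derivative_ones[OF sbp]
      element_flux_difference[where E = E and k = k, OF sbp] by simp
qed

text \<open>
  With \<open>w = a u\<close> itself as test vector, \<open>w\<^sup>T M D w\<close> is its own mirror image under summation by
  parts, hence half a boundary term.
\<close>

lemma element_energy_rate:
  fixes N x E a h \<gamma> U k
  assumes sbp: "sbp_discretisation q l r (E k)" and U: "U k \<in> carrier_vec (size_of (E k))"
  shows "2 * (U k \<bullet> ((transpose_mat (mult_op a (E k)) * Mmat (E k)) *\<^sub>v semi_rhs N x E a h \<gamma> U k))
    = (2 * au_L E a U k * num_flux N x E a h \<gamma> U (k - 1) - (au_L E a U k)\<^sup>2)
      - (2 * au_R E a U k * num_flux N x E a h \<gamma> U k - (au_R E a U k)\<^sup>2)"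
proof -
  let ?n = "size_of (E k)" and ?A = "mult_op a (E k)" and ?M = "Mmat (E k)"
  define w where "w = ?A *\<^sub>v U k"
  note A = mult_op_carrier[of a "E k"] and M = sbp_discretisationD(2)[OF sbp]
  have w: "w \<in> carrier_vec ?n" unfolding w_def by (rule mult_mat_vec_carrier[OF A U])
  have Rw: "Rmat (E k) *\<^sub>v w = au_bdry a (E k) (U k)" by (simp add: au_bdry_def w_def)
  have Rw_carrier: "au_bdry a (E k) (U k) \<in> carrier_vec 2" by (rule au_bdry_carrier[OF sbp U])
  have rhs: "semi_rhs N x E a h \<gamma> U k \<in> carrier_vec ?n"
    using sym_pos_def_minv(1)[OF sbp_discretisationD(4)[OF sbp]]
    by (intro carrier_vecI) (simp add: semi_rhs_def)
  have AT: "transpose_mat ?A \<in> carrier_mat ?n ?n" using A by simp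
  have "U k \<bullet> ((transpose_mat ?A * ?M) *\<^sub>v semi_rhs N x E a h \<gamma> U k)
      = w \<bullet> (?M *\<^sub>v semi_rhs N x E a h \<gamma> U k)"
    unfolding assoc_mult_mat_vec[OF AT M rhs] w_def
    by (rule scalar_prod_transpose_mult[OF A U mult_mat_vec_carrier[OF M rhs]])
  also have "\<dots> = w \<bullet> (?M *\<^sub>v (Dmat (E k) *\<^sub>v w))
      - au_bdry a (E k) (U k) \<bullet> (Bmat *\<^sub>v flux_vec N x E a h \<gamma> U k)"
    using semi_rhs_weak_form[where E = E and k = k and U = U, OF sbp w U] Rw by (simp add: w_def)
  finally show ?thesis
    using sbp_summation_by_parts[OF sbp w w]
    unfolding Rw scalar_prod_Bmat[OF Rw_carrier flux_vec_carrier]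
      scalar_prod_Bmat[OF Rw_carrier Rw_carrier] flux_vec_nth
    by (simp add: au_L_def au_R_def power2_eq_square algebra_simps)
qed


section \<open>Differentiating vector-valued functions\<close>

lemma has_real_derivative_scalar_prod:
  assumes v: "has_vec_deriv n v v' t T" and w: "has_vec_deriv n w w' t T" and t: "t \<in> T"
  shows "((\<lambda>s. v s \<bullet> w s) has_real_derivative v t \<bullet> w' + v' \<bullet> w t) (at t within T)"
proof -
  have car: "\<And>s. s \<in> T \<Longrightarrow> dim_vec (v s) = n \<and> dim_vec (w s) = n"
    "w' \<in> carrier_vec n"
    using v w by (auto simp: has_vec_deriv_def)
  have D: "((\<lambda>s. \<Sum>i<n. v s $ i * w s $ i) has_real_derivative
      (\<Sum>i<n. v t $ i * w' $ i + v' $ i * w t $ i)) (at t within T)"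
    using v w unfolding has_vec_deriv_def by (intro DERIV_sum DERIV_mult') auto
  have val: "(\<Sum>i<n. v t $ i * w' $ i + v' $ i * w t $ i) = v t \<bullet> w' + v' \<bullet> w t"
    using car(1)[OF t] carrier_vecD[OF car(2)]
    by (simp add: scalar_prod_def sum.distrib atLeast0LessThan)
  have prod: "(\<Sum>i<n. v s $ i * w s $ i) = v s \<bullet> w s" if "s \<in> T" for s
    using car(1)[OF that] by (simp add: scalar_prod_def atLeast0LessThan)
  \<comment> \<open>The dimensions are controlled on \<open>T\<close> only, so the two functions agree there and perhaps nowhere else.\<close>
  show ?thesis
    using D unfolding val
    by (rule has_field_derivative_transform_within[where d = 1]) (simp_all add: t prod)
qed

lemma has_vec_deriv_const:
  "c \<in> carrier_vec n \<Longrightarrow> has_vec_deriv n (\<lambda>_. c) (0\<^sub>v n) t T"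
  by (simp add: has_vec_deriv_def)

lemma has_vec_deriv_mult_mat:
  assumes A: "A \<in> carrier_mat m n" and v: "has_vec_deriv n v v' t T" and t: "t \<in> T"
  shows "has_vec_deriv m (\<lambda>s. A *\<^sub>v v s) (A *\<^sub>v v') t T"
proof -
  have car: "\<And>s. s \<in> T \<Longrightarrow> v s \<in> carrier_vec n" "v' \<in> carrier_vec n"
    using v by (auto simp: has_vec_deriv_def)
  have "((\<lambda>s. (A *\<^sub>v v s) $ i) has_real_derivative (A *\<^sub>v v') $ i) (at t within T)" if i: "i < m" for i
  proof -
    have row: "row A i \<in> carrier_vec n" using A i by simp
    have "((\<lambda>s. row A i \<bullet> v s) has_real_derivative row A i \<bullet> v') (at t within T)"
      using has_real_derivative_scalar_prod[OF has_vec_deriv_const[OF row] v t] car(1)[OF t] by simp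
    then show ?thesis using A i by simp
  qed
  then show ?thesis
    using A car mult_mat_vec_carrier[OF A] by (auto simp: has_vec_deriv_def)
qed

lemma has_real_derivative_linear_form:
  assumes "c \<in> carrier_vec m" "A \<in> carrier_mat m n" "has_vec_deriv n v v' t T" "t \<in> T"
  shows "((\<lambda>s. c \<bullet> (A *\<^sub>v v s)) has_real_derivative c \<bullet> (A *\<^sub>v v')) (at t within T)"
proof -
  have "A *\<^sub>v v t \<in> carrier_vec m" 
    using assms by (intro mult_mat_vec_carrier[of A]) (auto simp: has_vec_deriv_def)
  then show ?thesis
    using has_real_derivative_scalar_prod[OF has_vec_deriv_const[OF assms(1)]
        has_vec_deriv_mult_mat[OF assms(2-4)] assms(4)] by simp
qed

lemma has_real_derivative_norm_sq:
  assumes A: "sym_pos_def n A" and v: "has_vec_deriv n v v' t T" and t: "t \<in> T"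
  shows "((\<lambda>s. norm_sq A (v s)) has_real_derivative 2 * (v t \<bullet> (A *\<^sub>v v'))) (at t within T)"
proof -
  have "A \<in> carrier_mat n n" using A by (simp add: sym_pos_def_def)
  from has_real_derivative_scalar_prod[OF v has_vec_deriv_mult_mat[OF this v t] t]
  have "((\<lambda>s. v s \<bullet> (A *\<^sub>v v s)) has_real_derivative v t \<bullet> (A *\<^sub>v v') + v' \<bullet> (A *\<^sub>v v t)) (at t within T)" .
  moreover have "v' \<bullet> (A *\<^sub>v v t) = v t \<bullet> (A *\<^sub>v v')"
    using v t by (intro sym_pos_def_bilinear_commute[OF A]) (auto simp: has_vec_deriv_def)
  ultimately show ?thesis by (simp add: norm_sq_def)
qed


section \<open>Summing over the elements\<close>

lemma semi_solutionD:
  assumes "semi_solution N x E a h g \<tau> u" "t \<in> {0..\<tau>}" "k \<in> {1..N}"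
  shows "has_vec_deriv (size_of (E k)) (\<lambda>s. u s k) (semi_rhs N x E a h (g t) (u t) k) t {0..\<tau>}"
    and "u t k \<in> carrier_vec (size_of (E k))"
  using assms by (auto simp: semi_solution_def has_vec_deriv_def)

text \<open>
  \<open>P k\<close> and \<open>Q k\<close> stand for the contributions of the left and the right end of element \<open>k\<close>; those
  meeting at the grid point \<open>k\<close> are \<open>Q k\<close> and \<open>P (k + 1)\<close>.
\<close>

lemma sum_regroup_at_interfaces:
  fixes P Q :: "nat \<Rightarrow> real"
  assumes "1 \<le> N"
  shows "(\<Sum>k=1..N. P k - Q k) = P 1 - Q N + (\<Sum>k=1..<N. P (k + 1) - Q k)"
  using assms
proof (induction N rule: nat_induct_at_least)
  case (Suc n)
  then show ?case by (simp add: sum.atLeastLessThan_Suc)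
qed simp

lemma sbp_conservative:
  assumes sbp: "\<forall>k\<in>{1..N}. sbp_discretisation (q k) (x (k - 1)) (x k) (E k)" and N: "1 \<le> N"
  shows "conservative N x E a h g"
  unfolding conservative_def
proof (intro allI impI ballI conjI)
  fix \<tau> u t k
  assume sol: "semi_solution N x E a h g \<tau> u" and t: "t \<in> {0..\<tau>}" and k: "k \<in> {1..N}"
  have sbp_k: "sbp_discretisation (q k) (x (k - 1)) (x k) (E k)" using sbp k by blast
  note U = semi_solutionD[OF sol t k]
  show "\<exists>u'. has_vec_deriv (size_of (E k)) (\<lambda>s. u s k) u' t {0..\<tau>} \<and>
      ones (size_of (E k)) \<bullet> (Mmat (E k) *\<^sub>v u')
        = - (ones (size_of (E k)) \<bullet>
              ((transpose_mat (Rmat (E k)) * Bmat) *\<^sub>v flux_vec N x E a h (g t) (u t) k)) \<and>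
      ones (size_of (E k)) \<bullet> (Mmat (E k) *\<^sub>v u')
        = num_flux N x E a h (g t) (u t) (k - 1) - num_flux N x E a h (g t) (u t) k"
    using U(1) element_mass_rate[where E = E and k = k and U = "u t", OF sbp_k U(2)]
    by (intro exI[of _ "semi_rhs N x E a h (g t) (u t) k"])
       (simp add: element_flux_ones[where E = E and k = k, OF sbp_k] element_flux_difference[where E = E and k = k, OF sbp_k])
next
  fix \<tau> u t
  assume sol: "semi_solution N x E a h g \<tau> u" and t: "t \<in> {0..\<tau>}"
  let ?f = "num_flux N x E a h (g t) (u t)"
  have "((\<lambda>s. total_mass N E (u s)) has_real_derivative (\<Sum>k=1..N. ?f (k - 1) - ?f k))
      (at t within {0..\<tau>})"
    unfolding total_mass_def
  proof (rule DERIV_sum)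
    fix k assume k: "k \<in> {1..N}"
    then have sbp_k: "sbp_discretisation (q k) (x (k - 1)) (x k) (E k)" using sbp by blast
    note U = semi_solutionD[OF sol t k]
    show "((\<lambda>s. ones (size_of (E k)) \<bullet> (Mmat (E k) *\<^sub>v u s k)) has_real_derivative
        ?f (k - 1) - ?f k) (at t within {0..\<tau>})"
      using has_real_derivative_linear_form[OF ones_carrier sbp_discretisationD(2)[OF sbp_k] U(1) t]
      unfolding element_mass_rate[where E = E and k = k and U = "u t", OF sbp_k U(2)] .
  qed
  moreover have "(\<Sum>k=1..N. ?f (k - 1) - ?f k) = ?f 0 - ?f N"
    using sum_regroup_at_interfaces[OF N, of "\<lambda>k. ?f (k - 1)" ?f] by simp
  ultimately show "((\<lambda>s. total_mass N E (u s)) has_real_derivative ?f 0 - ?f N)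
      (at t within {0..\<tau>})" by simp
qed

lemma energy_rate:
  assumes N: "1 \<le> N"
    and sbp: "\<forall>k\<in>{1..N}. sbp_discretisation (q k) (x (k - 1)) (x k) (E k)"
    and spd: "\<forall>k\<in>{1..N}. sym_pos_def (size_of (E k)) (transpose_mat (mult_op a (E k)) * Mmat (E k))"
    and sol: "semi_solution N x E a h g \<tau> u" and t: "t \<in> {0..\<tau>}"
  shows "((\<lambda>s. energy N E a (u s)) has_real_derivative
           exterior_contribution N x E a h (g t) (u t)
           + (\<Sum>k=1..<N. interior_contribution N x E a h (g t) (u t) k)) (at t within {0..\<tau>})"
proof -
  let ?f = "num_flux N x E a h (g t) (u t)" and ?L = "au_L E a (u t)" and ?R = "au_R E a (u t)"
  define P where "P k = 2 * ?L k * ?f (k - 1) - (?L k)\<^sup>2" for k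
  define Q where "Q k = 2 * ?R k * ?f k - (?R k)\<^sup>2" for k
  have "((\<lambda>s. energy N E a (u s)) has_real_derivative (\<Sum>k=1..N. P k - Q k)) (at t within {0..\<tau>})"
    unfolding energy_def
  proof (rule DERIV_sum)
    fix k assume k: "k \<in> {1..N}"
    let ?A = "transpose_mat (mult_op a (E k)) * Mmat (E k)"
    have sbp_k: "sbp_discretisation (q k) (x (k - 1)) (x k) (E k)"
      and spd_k: "sym_pos_def (size_of (E k)) ?A" using sbp spd k by blast+
    note U = semi_solutionD[OF sol t k]
    show "((\<lambda>s. norm_sq ?A (u s k)) has_real_derivative P k - Q k) (at t within {0..\<tau>})"
      using has_real_derivative_norm_sq[OF spd_k U(1) t]
      unfolding element_energy_rate[where E = E and k = k and U = "u t", OF sbp_k U(2)] P_def Q_def .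
  qed
  moreover have "P 1 - Q N = exterior_contribution N x E a h (g t) (u t)"
    by (simp add: P_def Q_def exterior_contribution_def)
  moreover have "P (k + 1) - Q k = interior_contribution N x E a h (g t) (u t) k"
    if "k \<in> {1..<N}" for k
    using that
    by (simp add: P_def Q_def interior_contribution_def au_plus_def au_minus_def algebra_simps)
  ultimately show ?thesis
    unfolding sum_regroup_at_interfaces[OF N] by simp
qed


section \<open>Upwind and central fluxes\<close>

lemma interior_contribution_upwind:
  assumes "h k = upwind_flux"
  shows "interior_contribution N x E a h \<gamma> U k = - (au_plus N E a U k - au_minus x E a \<gamma> U k)\<^sup>2"
  using assms
  by (simp add: interior_contribution_def num_flux_def upwind_flux_def power2_eq_square algebra_simps)

lemma interior_contribution_central:
  assumes "h k = central_flux"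
  shows "interior_contribution N x E a h \<gamma> U k = 0"
  using assms
  by (simp add: interior_contribution_def num_flux_def central_flux_def power2_eq_square field_simps)

text \<open>The two sides differ by the square of the jump between the inflow datum and \<open>(au)\<^sub>L\<close>.\<close>

lemma exterior_contribution_upwind:
  assumes "h 0 = upwind_flux" "h N = upwind_flux" "1 \<le> N"
  shows "exterior_contribution N x E a h \<gamma> U \<le> (a (x 0) * \<gamma>)\<^sup>2 - (au_R E a U N)\<^sup>2"
proof -
  have "0 \<le> (a (x 0) * \<gamma> - au_L E a U 1)\<^sup>2" by simp
  then show ?thesis
    using assms
    by (simp add: exterior_contribution_def num_flux_def upwind_flux_def au_minus_def
        power2_eq_square algebra_simps)
qed

theorem theorem7:
  fixes N :: nat and x :: "nat \<Rightarrow> real" and q :: "nat \<Rightarrow> nat" and E :: "nat \<Rightarrow> sbp"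
    and a :: "real \<Rightarrow> real" and g :: "real \<Rightarrow> real" and h :: "nat \<Rightarrow> real \<Rightarrow> real \<Rightarrow> real"
  assumes "1 \<le> N"
    and "\<forall>k<N. x k < x (k + 1)"
    and "\<forall>y\<in>{x 0<..<x N}. 0 < a y"
    and "\<forall>k\<in>{1..N}. sbp_discretisation (q k) (x (k - 1)) (x k) (E k)"
    and "\<forall>k\<in>{1..N}. sym_pos_def (size_of (E k)) (transpose_mat (mult_op a (E k)) * Mmat (E k))"
  shows
    "(h 0 = upwind_flux \<and> h N = upwind_flux \<and>
        (\<forall>k\<in>{1..<N}. h k = upwind_flux \<or> h k = central_flux)
        \<longrightarrow> conservative N x E a h g \<and> energy_stable N x E a h g) \<and>
     (\<forall>\<tau>>0. \<forall>u. semi_solution N x E a h g \<tau> u \<longrightarrow> (\<forall>t\<in>{0..\<tau>}.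
        ((\<lambda>s. energy N E a (u s)) has_real_derivative
           exterior_contribution N x E a h (g t) (u t)
           + (\<Sum>k=1..<N. interior_contribution N x E a h (g t) (u t) k)) (at t within {0..\<tau>}))) \<and>
     (\<forall>\<gamma> U. \<forall>k\<in>{1..<N}.
        (h k = upwind_flux \<longrightarrow> interior_contribution N x E a h \<gamma> U k \<le> 0) \<and>
        (h k = central_flux \<longrightarrow> interior_contribution N x E a h \<gamma> U k = 0))"
proof (intro conjI impI allI ballI)
  show "conservative N x E a h g" by (rule sbp_conservative[OF assms(4,1)])
next
  assume fluxes: "h 0 = upwind_flux \<and> h N = upwind_flux \<and>
    (\<forall>k\<in>{1..<N}. h k = upwind_flux \<or> h k = central_flux)"
  have bound: "exterior_contribution N x E a h \<gamma> U + (\<Sum>k=1..<N. interior_contribution N x E a h \<gamma> U k)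
      \<le> (a (x 0) * \<gamma>)\<^sup>2 - (au_R E a U N)\<^sup>2" for \<gamma> U
  proof -
    have "interior_contribution N x E a h \<gamma> U k \<le> 0" if "k \<in> {1..<N}" for k
      using fluxes that interior_contribution_upwind[of h k] interior_contribution_central[of h k]
      by fastforce
    then have "(\<Sum>k=1..<N. interior_contribution N x E a h \<gamma> U k) \<le> 0" by (rule sum_nonpos)
    then show ?thesis
      using exterior_contribution_upwind[of h N x E a \<gamma> U] fluxes assms(1) by simp
  qed
  show "energy_stable N x E a h g"
    unfolding energy_stable_def
  proof (intro allI impI ballI)
    fix \<tau> u t
    assume sol: "semi_solution N x E a h g \<tau> u" and t: "t \<in> {0..\<tau>}"
    show "\<exists>e'. ((\<lambda>s. energy N E a (u s)) has_real_derivative e') (at t within {0..\<tau>}) \<and>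
        e' \<le> (a (x 0) * g t)\<^sup>2 - (au_R E a (u t) N)\<^sup>2 \<and>
        (a (x 0) * g t)\<^sup>2 - (au_R E a (u t) N)\<^sup>2 \<le> (a (x 0) * g t)\<^sup>2"
      using energy_rate[OF assms(1,4,5) sol t] bound[of "g t" "u t"] by auto
  qed
next
  fix \<tau> u t
  assume "semi_solution N x E a h g \<tau> u" "t \<in> {0..\<tau>}"
  then show "((\<lambda>s. energy N E a (u s)) has_real_derivative
      exterior_contribution N x E a h (g t) (u t)
      + (\<Sum>k=1..<N. interior_contribution N x E a h (g t) (u t) k)) (at t within {0..\<tau>})"
    by (rule energy_rate[OF assms(1,4,5)])
next
  fix \<gamma> U k
  assume "h k = upwind_flux"
  then show "interior_contribution N x E a h \<gamma> U k \<le> 0"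
    by (simp add: interior_contribution_upwind)
next
  fix \<gamma> U k
  assume "h k = central_flux"
  then show "interior_contribution N x E a h \<gamma> U k = 0"
    by (rule interior_contribution_central)
qed

end
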